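(* Let $\mu,\omega:\mathbb{Z}\to\mathbb{R}^+$ be growth rates such that $\mu$ is weakly faster than $\omega$, and fix a real number $a>0$. Then, for the system $x(k+1)=A(k)x(k)$, $k\in\mathbb{Z}$: (i) if $\Sigma_{\mu\mathrm{D}}(A)\subset[-\infty,-a]$, then $\Sigma_{\omega\mathrm{D}}(A)\subset[-\infty,-a]$; (ii) if $\Sigma_{\mu\mathrm{D}}(A)\subset[a,+\infty]$, then $\Sigma_{\omega\mathrm{D}}(A)\subset[a,+\infty]$.
   Context: System: $A:\mathbb{Z}\to GL_d(\mathbb{R})$, and $x(k+1)=A(k)x(k)$, $k\in\mathbb{Z}$. Its evolution operator is $\Phi(k,n)=A(k-1)\cdots A(n)$ for $k>n$, $\Phi(n,n)=\mathrm{Id}$, $\Phi(k,n)=A^{-1}(k)\cdots A^{-1}(n-1)$ for $k<n$. Growth rate: a non-decreasing map $\mu:\mathbb{Z}\to\mathbb{R}^+=(0,\infty)$ with $\mu(0)=1$, $\lim_{n\to+\infty}\mu(n)=+\infty$, $\lim_{n\to-\infty}\mu(n)=0$. Weakly faster: $\mu$ is weakly faster than $\omega$ if for every $\alpha<0$ there is $M\ge1$ such that $\left(\frac{\mu(k)}{\mu(n)}\right)^{\alpha}\le M\left(\frac{\omega(k)}{\omega(n)}\right)^{\alpha}$ for all integers $k\ge n$. Invariant projector: a map $n\mapsto \mathrm{P}(n)$ of idempotent $d\times d$ matrices with $A(k)\mathrm{P}(k)=\mathrm{P}(k+1)A(k)$ for all $k\in\mathbb{Z}$. $\mu$-dichotomy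 ($\mu$D): there are an invariant projector $\mathrm{P}$ and constants $K\ge1$, $\alpha<0$, $\beta>0$ with $\|\Phi(k,n)\mathrm{P}(n)\|\le K\left(\frac{\mu(k)}{\mu(n)}\right)^{\alpha}$ for all $k\ge n$ and $\|\Phi(k,n)[\mathrm{Id}-\mathrm{P}(n)]\|\le K\left(\frac{\mu(k)}{\mu(n)}\right)^{\beta}$ for all $k\le n$. Weighted system: for $\gamma\in\mathbb{R}$ the $(\mu,\gamma)$-weighted system is $x(k+1)=A(k)\left(\frac{\mu(k+1)}{\mu(k)}\right)^{-\gamma}x(k)$. By convention, the weighted system for $\gamma=+\infty$ admits $\mu$D if there is $\hat\gamma\in\mathbb{R}$ such that the $(\mu,\hat\gamma)$-weighted system admits $\mu$D with projector $\mathrm{P}\equiv\mathrm{Id}$; for $\gamma=-\infty$ it admits $\mu$D if there is $\hat\gamma\in\mathbb{R}$ such that the $(\mu,\hat\gamma)$-weighted system admits $\mu$D with projector $\mathrm{P}\equiv0$. Spectrum: $\Sigma_{\mu\mathrm{D}}(A)=\{\gamma\in\mathbb{R}\cup\{\pm\infty\}:\text{the }(\mu,\gamma)\text{-weighted system does not admit }\mu\mathrm{D}\}$; likewise with $\omega$ in place of $\mu$. Intervals are in the extended real line: $[-\infty,c]=(-\infty,c]\cup\{-\infty\}$, $[c,+\infty]=[c,+\infty)\cup\{+\infty\}$. *)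

theory Defs
  imports "HOL-Analysis.Analysis"
begin

definition growth_rate :: "(int \<Rightarrow> real) \<Rightarrow> bool" where
  "growth_rate \<mu> \<longleftrightarrow>
     (\<forall>n. 0 < \<mu> n) \<and> mono \<mu> \<and> \<mu> 0 = 1 \<and>
     filterlim \<mu> at_top at_top \<and> (\<mu> \<longlongrightarrow> 0) at_bot"

definition weakly_faster :: "(int \<Rightarrow> real) \<Rightarrow> (int \<Rightarrow> real) \<Rightarrow> bool" where
  "weakly_faster \<mu> \<omega> \<longleftrightarrow>
     (\<forall>\<alpha><0. \<exists>M\<ge>1. \<forall>k n. k \<ge> n \<longrightarrow>
        (\<mu> k / \<mu> n) powr \<alpha> \<le> M * (\<omega> k / \<omega> n) powr \<alpha>)"

text \<open>
  The two branches are the ordered products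
  \<open>A (k - 1) ** \<dots> ** A n\<close> and \<open>(A k)\<^sup>-\<^sup>1 ** \<dots> ** (A (n - 1))\<^sup>-\<^sup>1\<close>;
  for \<open>k = n\<close> the list is empty and the product is the identity matrix.
\<close>

definition evolution :: "(int \<Rightarrow> real^'n^'n) \<Rightarrow> int \<Rightarrow> int \<Rightarrow> real^'n^'n" where
  "evolution A k n =
     (if k \<ge> n then foldr (**) (map A (rev [n..k - 1])) (mat 1)
      else foldr (**) (map (\<lambda>j. matrix_inv (A j)) [k..n - 1]) (mat 1))"

definition invariant_projector ::
    "(int \<Rightarrow> real^'n^'n) \<Rightarrow> (int \<Rightarrow> real^'n^'n) \<Rightarrow> bool" where
  "invariant_projector A P \<longleftrightarrow>
     (\<forall>k. P k ** P k = P k) \<and> (\<forall>k. A k ** P k = P (k + 1) ** A k)"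

text \<open>
  The norm of a matrix is its operator norm with respect to the Euclidean norm
  (the library's \<open>norm\<close> on \<open>real^'n^'n\<close> is the Frobenius norm instead).
\<close>

definition dichotomy_with ::
    "(int \<Rightarrow> real) \<Rightarrow> (int \<Rightarrow> real^'n^'n) \<Rightarrow> (int \<Rightarrow> real^'n^'n) \<Rightarrow> bool" where
  "dichotomy_with \<mu> A P \<longleftrightarrow>
     invariant_projector A P \<and>
     (\<exists>K \<alpha> \<beta>. K \<ge> 1 \<and> \<alpha> < 0 \<and> \<beta> > 0 \<and>
        (\<forall>k n. k \<ge> n \<longrightarrow>
           onorm ((*v) (evolution A k n ** P n)) \<le> K * (\<mu> k / \<mu> n) powr \<alpha>) \<and>
        (\<forall>k n. k \<le> n \<longrightarrow>
           onorm ((*v) (evolution A k n ** (mat 1 - P n))) \<le> K * (\<mu> k / \<mu> n) powr \<beta>))"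

definition admits_dichotomy :: "(int \<Rightarrow> real) \<Rightarrow> (int \<Rightarrow> real^'n^'n) \<Rightarrow> bool" where
  "admits_dichotomy \<mu> A \<longleftrightarrow> (\<exists>P. dichotomy_with \<mu> A P)"

definition weighted ::
    "(int \<Rightarrow> real) \<Rightarrow> real \<Rightarrow> (int \<Rightarrow> real^'n^'n) \<Rightarrow> int \<Rightarrow> real^'n^'n" where
  "weighted \<mu> \<gamma> A k = ((\<mu> (k + 1) / \<mu> k) powr (- \<gamma>)) *\<^sub>R A k"

definition weighted_admits_dichotomy ::
    "(int \<Rightarrow> real) \<Rightarrow> (int \<Rightarrow> real^'n^'n) \<Rightarrow> ereal \<Rightarrow> bool" where
  "weighted_admits_dichotomy \<mu> A \<gamma> \<longleftrightarrow>
     (case \<gamma> of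
        ereal r \<Rightarrow> admits_dichotomy \<mu> (weighted \<mu> r A)
      | PInfty \<Rightarrow> \<exists>r. dichotomy_with \<mu> (weighted \<mu> r A) (\<lambda>_. mat 1)
      | MInfty \<Rightarrow> \<exists>r. dichotomy_with \<mu> (weighted \<mu> r A) (\<lambda>_. 0))"

definition dichotomy_spectrum ::
    "(int \<Rightarrow> real) \<Rightarrow> (int \<Rightarrow> real^'n^'n) \<Rightarrow> ereal set" where
  "dichotomy_spectrum \<mu> A = {\<gamma>. \<not> weighted_admits_dichotomy \<mu> A \<gamma>}"

end

theory Submission
  imports Defs
begin

text \<open>
  A spectrum contained in \<open>[-\<infinity>, -a]\<close> is nothing but a family of exponential-type bounds: it
  yields, for every \<open>c > -a\<close>, an estimate \<open>\<parallel>\<Phi>(k, n)\<parallel> \<le> K (\<mu>(k)/\<mu>(n))\<^sup>c\<close> for \<open>k \<ge> n\<close>.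
  Once this is known, the comparison of rates is immediate. Since \<open>a > 0\<close>, every
  \<open>\<gamma> > -a\<close> leaves room for a negative \<open>c\<close> with \<open>-a < c < \<gamma>\<close>; for negative exponents
  weak comparability replaces \<open>\<mu>\<close> by \<open>\<omega>\<close> in the estimate at the cost of a
  constant, and the \<open>(\<omega>, \<gamma>)\<close>-weighted system then has an \<open>\<omega>\<close>-dichotomy with projector
  \<open>Id\<close>, because weighting lowers the exponent from \<open>c\<close> to \<open>c - \<gamma> < 0\<close>.

  The point to prove is therefore that the projectors for all \<open>\<gamma> > -a\<close> are the identity, although
  the hypothesis, through the convention at \<open>+\<infinity>\<close>, provides this only for one weight of
  unspecified size. Let \<open>g\<close> be the infimum of the exponents \<open>c\<close> for which
  such an estimate holds, a set which is nonempty because \<open>+\<infinity>\<close> lies outside the spectrum. If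
  \<open>g > -a\<close>, then the \<open>(\<mu>, g)\<close>-weighted system has a dichotomy with some projector
  \<open>P\<close> and exponents \<open>\<alpha> < 0 < \<beta>\<close>. There is an admissible exponent \<open>c < g + \<beta>\<close>, and writing
  \<open>Id - P(n) = \<Phi>(n, k) (Id - P(k)) \<Phi>(k, n)\<close> bounds the norm of \<open>Id - P(n)\<close> by a multiple of
  \<open>(\<mu>(n)/\<mu>(k))\<^bsup>g + \<beta> - c\<^esup>\<close>, which tends to \<open>0\<close> as \<open>k \<rightarrow> \<infinity>\<close>. So \<open>P = Id\<close>, and the stable
  estimate makes \<open>g + \<alpha> < g\<close> admissible, a contradiction
  (\<open>forward_exponent_if_resolvent_above\<close>).

  The second half is the mirror image under reversal of time: \<open>P\<close> takes the place of
  \<open>Id - P\<close>, the supremum that of the infimum, and \<open>k \<rightarrow> -\<infinity>\<close> that of \<open>k \<rightarrow> \<infinity>\<close>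
  (\<open>backward_exponent_if_resolvent_below\<close>).
\<close>

section \<open>Matrix solutions and the evolution operator\<close>

lemma matrix_inv_inverse:
  fixes M :: "'a::semiring_1^'n^'m"
  assumes "invertible M"
  shows "M ** matrix_inv M = mat 1" and "matrix_inv M ** M = mat 1"
  using someI_ex[of "\<lambda>N. M ** N = mat 1 \<and> N ** M = mat 1"] assms
  by (auto simp: invertible_def matrix_inv_def)

lemma evolution_refl: "evolution A n n = mat 1"
  by (simp add: evolution_def)

lemma evolution_step:
  fixes A :: "int \<Rightarrow> real^'n^'n"
  assumes inv: "\<And>k. invertible (A k)"
  shows "evolution A (k + 1) n = A k ** evolution A k n"
proof (cases "k \<ge> n")
  case True
  then have "[n..k] = [n..k - 1] @ [k]"
    by (simp add: upto_rec2)
  with True show ?thesis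
    by (simp add: evolution_def)
next
  case False
  then have "[k..n - 1] = k # [k + 1..n - 1]"
    by (simp add: upto_rec1)
  with False have "evolution A k n = matrix_inv (A k) ** evolution A (k + 1) n"
    by (auto simp: evolution_def)
  then show ?thesis
    by (simp add: matrix_mul_assoc matrix_inv_inverse(1)[OF inv])
qed

text \<open>
  All identities for the evolution operator below follow from this one: both sides solve the same
  difference equation in the first time argument and agree at one instant. Invertibility of the
  coefficients is what carries the equality backwards in time.
\<close>

lemma matrix_solution_unique:
  fixes A X Y :: "int \<Rightarrow> real^'n^'n"
  assumes inv: "\<And>k. invertible (A k)"
    and X: "\<And>k. X (k + 1) = A k ** X k"
    and Y: "\<And>k. Y (k + 1) = A k ** Y k"
    and start: "X n = Y n"
  shows "X k = Y k"
proof (induction k rule: int_induct[where k = n])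
  case base
  show ?case by (rule start)
next
  case (step1 i)
  then show ?case by (simp add: X Y)
next
  case (step2 i)
  have "A (i - 1) ** X (i - 1) = A (i - 1) ** Y (i - 1)"
    using X[of "i - 1"] Y[of "i - 1"] step2 by simp
  then have "matrix_inv (A (i - 1)) ** A (i - 1) ** X (i - 1)
      = matrix_inv (A (i - 1)) ** A (i - 1) ** Y (i - 1)"
    by (simp add: matrix_mul_assoc[symmetric])
  then show ?case
    by (simp add: matrix_inv_inverse(2)[OF inv])
qed

lemma evolution_cocycle:
  fixes A :: "int \<Rightarrow> real^'n^'n"
  assumes inv: "\<And>k. invertible (A k)"
  shows "evolution A k m ** evolution A m n = evolution A k n"
  by (rule matrix_solution_unique[OF inv, where n = m
        and X = "\<lambda>k. evolution A k m ** evolution A m n" and Y = "\<lambda>k. evolution A k n"])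
    (simp_all add: evolution_step[OF inv] evolution_refl matrix_mul_assoc)

lemma evolution_intertwines_projector:
  fixes A :: "int \<Rightarrow> real^'n^'n"
  assumes inv: "\<And>k. invertible (A k)"
    and P: "invariant_projector A P"
  shows "evolution A k n ** P n = P k ** evolution A k n"
proof (rule matrix_solution_unique[OF inv, where n = n
        and X = "\<lambda>k. evolution A k n ** P n" and Y = "\<lambda>k. P k ** evolution A k n"])
  fix k
  have "A k ** P k = P (k + 1) ** A k"
    using P by (simp add: invariant_projector_def)
  then show "P (k + 1) ** evolution A (k + 1) n = A k ** (P k ** evolution A k n)"
    by (simp add: evolution_step[OF inv] matrix_mul_assoc)
qed (simp_all add: evolution_step[OF inv] evolution_refl matrix_mul_assoc)

lemma matrix_diff_distrib:
  fixes B C D :: "real^'n^'n"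
  shows "B ** (C - D) = B ** C - B ** D" and "(C - D) ** B = C ** B - D ** B"
  by (vector matrix_matrix_mult_def sum_subtractf[symmetric] algebra_simps)+

lemma invariant_projector_complement:
  fixes A :: "int \<Rightarrow> real^'n^'n"
  assumes "invariant_projector A P"
  shows "invariant_projector A (\<lambda>k. mat 1 - P k)"
  using assms
  by (simp add: invariant_projector_def matrix_diff_distrib)

text \<open>
  Transporting a projector along the flow to another instant and back: this is how an estimate at
  arbitrarily remote times acts on the projector at a fixed time.
\<close>

lemma projector_transport:
  fixes A :: "int \<Rightarrow> real^'n^'n"
  assumes inv: "\<And>k. invertible (A k)"
    and P: "invariant_projector A P"
  shows "P n = (evolution A n k ** P k) ** evolution A k n"
proof -
  have "(evolution A n k ** P k) ** evolution A k n
      = P n ** (evolution A n k ** evolution A k n)"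
    by (simp add: evolution_intertwines_projector[OF inv P] matrix_mul_assoc)
  then show ?thesis
    by (simp add: evolution_cocycle[OF inv] evolution_refl)
qed

section \<open>Operator norms\<close>

lemma onorm_matrix_mul_le:
  fixes X Y :: "real^'n^'n"
  shows "onorm ((*v) (X ** Y)) \<le> onorm ((*v) X) * onorm ((*v) Y)"
proof -
  have "(*v) (X ** Y) = (*v) X \<circ> (*v) Y"
    by (simp add: fun_eq_iff matrix_vector_mul_assoc)
  then show ?thesis
    by (simp add: onorm_compose)
qed

lemma onorm_matrix_nonneg: "0 \<le> onorm ((*v) (X :: real^'n^'n))"
  by (simp add: onorm_pos_le)

lemma onorm_matrix_scaleR:
  fixes X :: "real^'n^'n"
  shows "onorm ((*v) (c *\<^sub>R X)) = \<bar>c\<bar> * onorm ((*v) X)"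
proof -
  have "(*v) (c *\<^sub>R X) = (\<lambda>v. c *\<^sub>R (X *v v))"
    by (simp add: fun_eq_iff scaleR_matrix_vector_assoc)
  then show ?thesis
    by (simp add: onorm_scaleR)
qed

lemma onorm_matrix_zero: "onorm ((*v) (0 :: real^'n^'n)) = 0"
  using onorm_matrix_scaleR[of 0 "0 :: real^'n^'n"] by simp

lemma matrix_eq_zero_if_onorm_le_zero:
  fixes X :: "real^'n^'n"
  assumes "onorm ((*v) X) \<le> 0"
  shows "X = 0"
proof -
  have "onorm ((*v) X) = 0"
    using assms onorm_matrix_nonneg[of X] by simp
  then have "\<forall>v. X *v v = 0"
    using onorm_eq_0[of "(*v) X"] by simp
  then show ?thesis
    by (simp add: matrix_eq)
qed

lemma matrix_eq_zero_if_vanishing_bound: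
  fixes X :: "real^'n^'n" and r :: "int \<Rightarrow> real"
  assumes nontriv: "F \<noteq> bot"
    and lim: "(r \<longlongrightarrow> 0) F"
    and pos: "\<And>k. 0 \<le> r k"
    and e: "0 < e"
    and bound: "eventually (\<lambda>k. onorm ((*v) X) \<le> C * r k powr e) F"
  shows "X = 0"
proof -
  have "((\<lambda>k. r k powr e) \<longlongrightarrow> 0 powr e) F"
    by (rule tendsto_powr') (use lim pos e in auto)
  then have "((\<lambda>k. C * r k powr e) \<longlongrightarrow> C * 0) F"
    using e by (intro tendsto_mult_left) simp
  from tendsto_lowerbound[OF this bound nontriv]
  show ?thesis
    by (intro matrix_eq_zero_if_onorm_le_zero) simp
qed

section \<open>Weighted systems\<close>

lemma growth_rate_pos: "growth_rate \<mu> \<Longrightarrow> 0 < \<mu> n"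
  by (simp add: growth_rate_def)

lemma growth_rate_mono: "growth_rate \<mu> \<Longrightarrow> n \<le> k \<Longrightarrow> \<mu> n \<le> \<mu> k"
  by (simp add: growth_rate_def monoD)

lemma weighted_admits_dichotomy_simps:
  "weighted_admits_dichotomy \<mu> A (ereal r) \<longleftrightarrow> admits_dichotomy \<mu> (weighted \<mu> r A)"
  "weighted_admits_dichotomy \<mu> A \<infinity> \<longleftrightarrow> (\<exists>r. dichotomy_with \<mu> (weighted \<mu> r A) (\<lambda>_. mat 1))"
  "weighted_admits_dichotomy \<mu> A (- \<infinity>) \<longleftrightarrow> (\<exists>r. dichotomy_with \<mu> (weighted \<mu> r A) (\<lambda>_. 0))"
  by (simp_all add: weighted_admits_dichotomy_def)

lemma invertible_weighted:
  fixes A :: "int \<Rightarrow> real^'n^'n"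
  assumes "growth_rate \<mu>" "invertible (A k)"
  shows "invertible (weighted \<mu> \<gamma> A k)"
  using assms growth_rate_pos[OF assms(1), of k] growth_rate_pos[OF assms(1), of "k + 1"]
  unfolding weighted_def
  by (subst scalar_invertible_iff) auto

lemma evolution_weighted:
  fixes A :: "int \<Rightarrow> real^'n^'n"
  assumes \<mu>: "growth_rate \<mu>" and inv: "\<And>k. invertible (A k)"
  shows "evolution (weighted \<mu> \<gamma> A) k n = (\<mu> k / \<mu> n) powr (- \<gamma>) *\<^sub>R evolution A k n"
proof (rule matrix_solution_unique[where n = n and A = "weighted \<mu> \<gamma> A"
        and X = "\<lambda>k. evolution (weighted \<mu> \<gamma> A) k n"
        and Y = "\<lambda>k. (\<mu> k / \<mu> n) powr (- \<gamma>) *\<^sub>R evolution A k n"])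
  note pos = growth_rate_pos[OF \<mu>]
  show winv: "invertible (weighted \<mu> \<gamma> A k)" for k
    by (rule invertible_weighted[OF \<mu> inv])
  show "evolution (weighted \<mu> \<gamma> A) (k + 1) n = weighted \<mu> \<gamma> A k ** evolution (weighted \<mu> \<gamma> A) k n"
    for k by (rule evolution_step[OF winv])
  show "(\<mu> (k + 1) / \<mu> n) powr (- \<gamma>) *\<^sub>R evolution A (k + 1) n
      = weighted \<mu> \<gamma> A k ** ((\<mu> k / \<mu> n) powr (- \<gamma>) *\<^sub>R evolution A k n)" for k
  proof -
    have "\<mu> (k + 1) / \<mu> n = (\<mu> (k + 1) / \<mu> k) * (\<mu> k / \<mu> n)"
      using pos[of k] by simp
    then have "(\<mu> (k + 1) / \<mu> n) powr (- \<gamma>)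
        = (\<mu> (k + 1) / \<mu> k) powr (- \<gamma>) * (\<mu> k / \<mu> n) powr (- \<gamma>)"
      using pos[of k] pos[of "k + 1"] pos[of n] by (simp only: powr_mult)
    then show ?thesis
      by (simp add: weighted_def evolution_step[OF inv] scalar_matrix_assoc matrix_scalar_ac mult.commute)
  qed
  show "evolution (weighted \<mu> \<gamma> A) n n = (\<mu> n / \<mu> n) powr (- \<gamma>) *\<^sub>R evolution A n n"
    using pos[of n] by (simp add: evolution_refl)
qed

lemma invariant_projector_weighted:
  fixes A :: "int \<Rightarrow> real^'n^'n"
  assumes \<mu>: "growth_rate \<mu>"
  shows "invariant_projector (weighted \<mu> \<gamma> A) P \<longleftrightarrow> invariant_projector A P"
proof -
  have "(\<mu> (k + 1) / \<mu> k) powr (- \<gamma>) \<noteq> 0" for k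
    using growth_rate_pos[OF \<mu>, of k] growth_rate_pos[OF \<mu>, of "k + 1"] by simp
  then show ?thesis
    by (simp add: invariant_projector_def weighted_def scalar_matrix_assoc[symmetric]
        matrix_scalar_ac)
qed

text \<open>Weighting by \<open>\<gamma>\<close> shifts every exponent by \<open>\<gamma>\<close>.\<close>

lemma onorm_evolution_weighted_le_iff:
  fixes Q :: "real^'n^'n" and A :: "int \<Rightarrow> real^'n^'n"
  assumes \<mu>: "growth_rate \<mu>" and inv: "\<And>k. invertible (A k)"
  shows "onorm ((*v) (evolution (weighted \<mu> \<gamma> A) k n ** Q)) \<le> K * (\<mu> k / \<mu> n) powr c
    \<longleftrightarrow> onorm ((*v) (evolution A k n ** Q)) \<le> K * (\<mu> k / \<mu> n) powr (\<gamma> + c)"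
proof -
  define q where "q = \<mu> k / \<mu> n"
  have q: "0 < q"
    using growth_rate_pos[OF \<mu>] by (simp add: q_def)
  have shift: "onorm ((*v) (evolution (weighted \<mu> \<gamma> A) k n ** Q))
      = q powr (- \<gamma>) * onorm ((*v) (evolution A k n ** Q))"
    by (simp add: evolution_weighted[OF \<mu> inv] scalar_matrix_assoc[symmetric]
        onorm_matrix_scaleR q_def)
  have rhs: "K * q powr c = q powr (- \<gamma>) * (K * q powr (\<gamma> + c))"
    using q by (simp add: powr_add powr_minus)
  show ?thesis
    using q unfolding q_def[symmetric] shift rhs by simp
qed

section \<open>One-sided growth exponents\<close>

definition forward_exponent :: "(int \<Rightarrow> real) \<Rightarrow> (int \<Rightarrow> real^'n^'n) \<Rightarrow> real \<Rightarrow> bool" where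
  "forward_exponent \<mu> A c \<longleftrightarrow>
     (\<exists>K\<ge>1. \<forall>k n. k \<ge> n \<longrightarrow> onorm ((*v) (evolution A k n)) \<le> K * (\<mu> k / \<mu> n) powr c)"

definition backward_exponent :: "(int \<Rightarrow> real) \<Rightarrow> (int \<Rightarrow> real^'n^'n) \<Rightarrow> real \<Rightarrow> bool" where
  "backward_exponent \<mu> A c \<longleftrightarrow>
     (\<exists>K\<ge>1. \<forall>k n. k \<le> n \<longrightarrow> onorm ((*v) (evolution A k n)) \<le> K * (\<mu> k / \<mu> n) powr c)"

lemma forward_exponent_mono:
  assumes \<mu>: "growth_rate \<mu>" and "forward_exponent \<mu> A c" "c \<le> c'"
  shows "forward_exponent \<mu> A c'"
proof -
  from assms(2) obtain K where K: "K \<ge> 1"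
    "\<And>k n. k \<ge> n \<Longrightarrow> onorm ((*v) (evolution A k n)) \<le> K * (\<mu> k / \<mu> n) powr c"
    by (auto simp: forward_exponent_def)
  have "onorm ((*v) (evolution A k n)) \<le> K * (\<mu> k / \<mu> n) powr c'" if "k \<ge> n" for k n
  proof -
    have "(\<mu> k / \<mu> n) powr c \<le> (\<mu> k / \<mu> n) powr c'"
      using growth_rate_pos[OF \<mu>, of n] growth_rate_mono[OF \<mu> that] \<open>c \<le> c'\<close>
      by (intro powr_mono) auto
    then show ?thesis
      using K(2)[OF that] K(1)
      by (elim order_trans) (simp add: mult_left_mono)
  qed
  with K(1) show ?thesis
    unfolding forward_exponent_def by blast
qed

lemma backward_exponent_antimono:
  assumes \<mu>: "growth_rate \<mu>" and "backward_exponent \<mu> A c" "c' \<le> c"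
  shows "backward_exponent \<mu> A c'"
proof -
  from assms(2) obtain K where K: "K \<ge> 1"
    "\<And>k n. k \<le> n \<Longrightarrow> onorm ((*v) (evolution A k n)) \<le> K * (\<mu> k / \<mu> n) powr c"
    by (auto simp: backward_exponent_def)
  have "onorm ((*v) (evolution A k n)) \<le> K * (\<mu> k / \<mu> n) powr c'" if "k \<le> n" for k n
  proof -
    have "(\<mu> k / \<mu> n) powr c \<le> (\<mu> k / \<mu> n) powr c'"
      using growth_rate_pos[OF \<mu>, of n] growth_rate_pos[OF \<mu>, of k]
        growth_rate_mono[OF \<mu> that] \<open>c' \<le> c\<close>
      by (intro powr_mono') auto
    then show ?thesis
      using K(2)[OF that] K(1)
      by (elim order_trans) (simp add: mult_left_mono)
  qed
  with K(1) show ?thesis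
    unfolding backward_exponent_def by blast
qed

lemma weighted_dichotomyE:
  fixes A :: "int \<Rightarrow> real^'n^'n"
  assumes \<mu>: "growth_rate \<mu>" and inv: "\<And>k. invertible (A k)"
    and D: "dichotomy_with \<mu> (weighted \<mu> \<gamma> A) P"
  obtains K \<alpha> \<beta> where "invariant_projector A P" "K \<ge> 1" "\<alpha> < 0" "\<beta> > 0"
    "\<And>k n. k \<ge> n \<Longrightarrow> onorm ((*v) (evolution A k n ** P n)) \<le> K * (\<mu> k / \<mu> n) powr (\<gamma> + \<alpha>)"
    "\<And>k n. k \<le> n \<Longrightarrow>
      onorm ((*v) (evolution A k n ** (mat 1 - P n))) \<le> K * (\<mu> k / \<mu> n) powr (\<gamma> + \<beta>)"
proof -
  from D obtain K \<alpha> \<beta> where "invariant_projector A P" "K \<ge> 1" "\<alpha> < 0" "\<beta> > 0"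
    and "\<forall>k n. k \<ge> n \<longrightarrow>
      onorm ((*v) (evolution A k n ** P n)) \<le> K * (\<mu> k / \<mu> n) powr (\<gamma> + \<alpha>)"
    and "\<forall>k n. k \<le> n \<longrightarrow>
      onorm ((*v) (evolution A k n ** (mat 1 - P n))) \<le> K * (\<mu> k / \<mu> n) powr (\<gamma> + \<beta>)"
    unfolding dichotomy_with_def onorm_evolution_weighted_le_iff[OF \<mu> inv]
      invariant_projector_weighted[OF \<mu>]
    by (elim conjE exE)
  then show thesis
    by (intro that[of K \<alpha> \<beta>]) simp_all
qed

lemma forward_exponent_if_dichotomy_identity:
  fixes A :: "int \<Rightarrow> real^'n^'n"
  assumes \<mu>: "growth_rate \<mu>" and inv: "\<And>k. invertible (A k)"
    and D: "dichotomy_with \<mu> (weighted \<mu> \<gamma> A) (\<lambda>_. mat 1)"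
  shows "\<exists>c<\<gamma>. forward_exponent \<mu> A c"
proof -
  obtain K \<alpha> where K: "K \<ge> 1" "\<alpha> < 0"
    "\<And>k n. k \<ge> n \<Longrightarrow> onorm ((*v) (evolution A k n ** mat 1)) \<le> K * (\<mu> k / \<mu> n) powr (\<gamma> + \<alpha>)"
    by (rule weighted_dichotomyE[OF \<mu> inv D]) (rule that)
  then have "forward_exponent \<mu> A (\<gamma> + \<alpha>)"
    unfolding forward_exponent_def by (intro exI[of _ K]) simp
  with K(2) show ?thesis
    by (intro exI[of _ "\<gamma> + \<alpha>"]) simp
qed

lemma backward_exponent_if_dichotomy_zero:
  fixes A :: "int \<Rightarrow> real^'n^'n"
  assumes \<mu>: "growth_rate \<mu>" and inv: "\<And>k. invertible (A k)"
    and D: "dichotomy_with \<mu> (weighted \<mu> \<gamma> A) (\<lambda>_. 0)"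
  shows "\<exists>c>\<gamma>. backward_exponent \<mu> A c"
proof -
  obtain K \<beta> where K: "K \<ge> 1" "\<beta> > 0"
    "\<And>k n. k \<le> n \<Longrightarrow>
      onorm ((*v) (evolution A k n ** (mat 1 - 0))) \<le> K * (\<mu> k / \<mu> n) powr (\<gamma> + \<beta>)"
    by (rule weighted_dichotomyE[OF \<mu> inv D]) (rule that)
  then have "backward_exponent \<mu> A (\<gamma> + \<beta>)"
    unfolding backward_exponent_def by (intro exI[of _ K]) simp
  with K(2) show ?thesis
    by (intro exI[of _ "\<gamma> + \<beta>"]) simp
qed

lemma dichotomy_identity_if_forward_exponent:
  fixes A :: "int \<Rightarrow> real^'n^'n"
  assumes \<mu>: "growth_rate \<mu>" and inv: "\<And>k. invertible (A k)"
    and c: "forward_exponent \<mu> A c" "c < \<gamma>"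
  shows "dichotomy_with \<mu> (weighted \<mu> \<gamma> A) (\<lambda>_. mat 1)"
proof -
  from c(1) obtain K where K: "K \<ge> 1"
    "\<And>k n. k \<ge> n \<Longrightarrow> onorm ((*v) (evolution A k n)) \<le> K * (\<mu> k / \<mu> n) powr c"
    by (auto simp: forward_exponent_def)
  show ?thesis
    unfolding dichotomy_with_def onorm_evolution_weighted_le_iff[OF \<mu> inv]
      invariant_projector_weighted[OF \<mu>]
    \<comment> \<open>The complementary projector vanishes, so any positive second exponent serves.\<close>
    using K c(2)
    by (intro conjI exI[of _ K] exI[of _ "c - \<gamma>"] exI[of _ 1])
      (auto simp: invariant_projector_def onorm_matrix_zero)
qed

lemma dichotomy_zero_if_backward_exponent:
  fixes A :: "int \<Rightarrow> real^'n^'n"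
  assumes \<mu>: "growth_rate \<mu>" and inv: "\<And>k. invertible (A k)"
    and c: "backward_exponent \<mu> A c" "\<gamma> < c"
  shows "dichotomy_with \<mu> (weighted \<mu> \<gamma> A) (\<lambda>_. 0)"
proof -
  from c(1) obtain K where K: "K \<ge> 1"
    "\<And>k n. k \<le> n \<Longrightarrow> onorm ((*v) (evolution A k n)) \<le> K * (\<mu> k / \<mu> n) powr c"
    by (auto simp: backward_exponent_def)
  show ?thesis
    unfolding dichotomy_with_def onorm_evolution_weighted_le_iff[OF \<mu> inv]
      invariant_projector_weighted[OF \<mu>]
    using K c(2)
    by (intro conjI exI[of _ K] exI[of _ "-1"] exI[of _ "c - \<gamma>"])
      (auto simp: invariant_projector_def onorm_matrix_zero)
qed

section \<open>Rigidity of the projector\<close>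

text \<open>
  A forward bound with exponent \<open>c\<close> forbids directions that expand at a rate above \<open>c\<close>: a vector in
  the range of \<open>Id - P(n)\<close>, followed to time \<open>k\<close> and brought back, would be contracted by an
  arbitrarily small factor.
\<close>

lemma projector_eq_identity:
  fixes A :: "int \<Rightarrow> real^'n^'n"
  assumes \<mu>: "growth_rate \<mu>" and inv: "\<And>k. invertible (A k)"
    and P: "invariant_projector A P"
    and unst: "\<And>k n. k \<le> n \<Longrightarrow>
      onorm ((*v) (evolution A k n ** (mat 1 - P n))) \<le> K * (\<mu> k / \<mu> n) powr b"
    and c: "forward_exponent \<mu> A c" "c < b"
  shows "P n = mat 1"
proof -
  note pos = growth_rate_pos[OF \<mu>]
  from c(1) obtain L where L: "L \<ge> 1"
    "\<And>k n. k \<ge> n \<Longrightarrow> onorm ((*v) (evolution A k n)) \<le> L * (\<mu> k / \<mu> n) powr c"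
    by (auto simp: forward_exponent_def)
  have bound: "onorm ((*v) (mat 1 - P n)) \<le> K * L * (\<mu> n / \<mu> k) powr (b - c)" if "n \<le> k" for k
  proof -
    have "onorm ((*v) (mat 1 - P n))
        \<le> onorm ((*v) (evolution A n k ** (mat 1 - P k))) * onorm ((*v) (evolution A k n))"
      using onorm_matrix_mul_le
        projector_transport[OF inv invariant_projector_complement[OF P], of n k] by metis
    also have "\<dots> \<le> (K * (\<mu> n / \<mu> k) powr b) * (L * (\<mu> k / \<mu> n) powr c)"
      using unst[OF that] L(2)[OF that] onorm_matrix_nonneg
      by (intro mult_mono) (auto intro: order_trans[OF onorm_matrix_nonneg])
    also have "(\<mu> k / \<mu> n) powr c = (\<mu> n / \<mu> k) powr (- c)"
      using pos[of k] pos[of n] by (simp add: powr_minus_divide powr_divide)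
    also have "(K * (\<mu> n / \<mu> k) powr b) * (L * (\<mu> n / \<mu> k) powr (- c))
        = K * L * (\<mu> n / \<mu> k) powr (b - c)"
      by (simp add: powr_add[symmetric] ac_simps flip: add_uminus_conv_diff)
    finally show ?thesis .
  qed
  have lim: "((\<lambda>k. \<mu> n / \<mu> k) \<longlongrightarrow> 0) at_top"
    by (rule real_tendsto_divide_at_top[OF tendsto_const])
      (use \<mu> in \<open>simp add: growth_rate_def\<close>)
  have ev: "eventually (\<lambda>k. onorm ((*v) (mat 1 - P n)) \<le> K * L * (\<mu> n / \<mu> k) powr (b - c)) at_top"
    using eventually_ge_at_top[of n] by eventually_elim (rule bound)
  have nonneg: "0 \<le> \<mu> n / \<mu> k" for k
    using pos[of n] pos[of k] by simp
  have "mat 1 - P n = 0"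
    by (rule matrix_eq_zero_if_vanishing_bound[OF _ lim nonneg _ ev]) (use c(2) in auto)
  then show ?thesis by simp
qed

text \<open>
  Here the range of \<open>P(n)\<close> is followed into the past: a backward bound with exponent \<open>c\<close> is too
  small there to be compatible with forward decay at a rate \<open>b < c\<close>.
\<close>

lemma projector_eq_zero:
  fixes A :: "int \<Rightarrow> real^'n^'n"
  assumes \<mu>: "growth_rate \<mu>" and inv: "\<And>k. invertible (A k)"
    and P: "invariant_projector A P"
    and stab: "\<And>k n. k \<ge> n \<Longrightarrow>
      onorm ((*v) (evolution A k n ** P n)) \<le> K * (\<mu> k / \<mu> n) powr b"
    and c: "backward_exponent \<mu> A c" "b < c"
  shows "P n = 0"
proof -
  note pos = growth_rate_pos[OF \<mu>]
  from c(1) obtain L where L: "L \<ge> 1"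
    "\<And>k n. k \<le> n \<Longrightarrow> onorm ((*v) (evolution A k n)) \<le> L * (\<mu> k / \<mu> n) powr c"
    by (auto simp: backward_exponent_def)
  have bound: "onorm ((*v) (P n)) \<le> K * L * (\<mu> k / \<mu> n) powr (c - b)" if "k \<le> n" for k
  proof -
    have "onorm ((*v) (P n))
        \<le> onorm ((*v) (evolution A n k ** P k)) * onorm ((*v) (evolution A k n))"
      using onorm_matrix_mul_le projector_transport[OF inv P, of n k] by metis
    also have "\<dots> \<le> (K * (\<mu> n / \<mu> k) powr b) * (L * (\<mu> k / \<mu> n) powr c)"
      using stab[OF that] L(2)[OF that] onorm_matrix_nonneg
      by (intro mult_mono) (auto intro: order_trans[OF onorm_matrix_nonneg])
    also have "(\<mu> n / \<mu> k) powr b = (\<mu> k / \<mu> n) powr (- b)"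
      using pos[of k] pos[of n] by (simp add: powr_minus_divide powr_divide)
    also have "(K * (\<mu> k / \<mu> n) powr (- b)) * (L * (\<mu> k / \<mu> n) powr c)
        = K * L * (\<mu> k / \<mu> n) powr (c - b)"
      by (simp add: powr_add[symmetric] ac_simps flip: add_uminus_conv_diff)
    finally show ?thesis .
  qed
  have "(\<mu> \<longlongrightarrow> 0) at_bot"
    using \<mu> by (simp add: growth_rate_def)
  then have lim: "((\<lambda>k. \<mu> k / \<mu> n) \<longlongrightarrow> 0) at_bot"
    by (rule tendsto_divide_zero)
  have ev: "eventually (\<lambda>k. onorm ((*v) (P n)) \<le> K * L * (\<mu> k / \<mu> n) powr (c - b)) at_bot"
    using eventually_le_at_bot[of n] by eventually_elim (rule bound)
  have nonneg: "0 \<le> \<mu> k / \<mu> n" for k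
    using pos[of n] pos[of k] by simp
  show ?thesis
    by (rule matrix_eq_zero_if_vanishing_bound[OF _ lim nonneg _ ev]) (use c(2) in auto)
qed

section \<open>From a half-line of dichotomies to growth exponents\<close>

text \<open>
  The infimum of the admissible exponents cannot lie in the open half-line above \<open>s\<close>: a dichotomy
  there has the identity as projector, and its strict stable rate then undercuts the infimum.
\<close>

lemma forward_exponent_if_resolvent_above:
  fixes A :: "int \<Rightarrow> real^'n^'n"
  assumes \<mu>: "growth_rate \<mu>" and inv: "\<And>k. invertible (A k)"
    and top: "weighted_admits_dichotomy \<mu> A \<infinity>"
    and above: "\<And>\<gamma>. s < \<gamma> \<Longrightarrow> weighted_admits_dichotomy \<mu> A (ereal \<gamma>)"
    and c: "s < c"
  shows "forward_exponent \<mu> A c"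
proof (rule ccontr)
  assume not_c: "\<not> forward_exponent \<mu> A c"
  define G where "G = {x. forward_exponent \<mu> A x}"
  define g where "g = Inf G"
  have lower: "c \<le> x" if "x \<in> G" for x
    using that not_c forward_exponent_mono[OF \<mu>, of A x c] by (force simp: G_def)
  then have bdd: "bdd_below G"
    by (rule bdd_belowI)
  from top obtain r where "dichotomy_with \<mu> (weighted \<mu> r A) (\<lambda>_. mat 1)"
    by (auto simp: weighted_admits_dichotomy_simps)
  from forward_exponent_if_dichotomy_identity[OF \<mu> inv this] have nonempty: "G \<noteq> {}"
    by (auto simp: G_def)
  have "c \<le> g"
    unfolding g_def by (rule cInf_greatest[OF nonempty lower])
  with c obtain P where D: "dichotomy_with \<mu> (weighted \<mu> g A) P"
    using above[of g] by (auto simp: weighted_admits_dichotomy_simps admits_dichotomy_def)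
  obtain K \<beta> where P: "invariant_projector A P" and \<beta>: "\<beta> > 0"
    and unst: "\<And>k n. k \<le> n \<Longrightarrow>
      onorm ((*v) (evolution A k n ** (mat 1 - P n))) \<le> K * (\<mu> k / \<mu> n) powr (g + \<beta>)"
    by (rule weighted_dichotomyE[OF \<mu> inv D]) (rule that)
  from \<beta> obtain x where x: "x \<in> G" "x < g + \<beta>"
    using cInf_lessD[OF nonempty, of "g + \<beta>"] by (auto simp: g_def)
  then have "P n = mat 1" for n
    by (intro projector_eq_identity[OF \<mu> inv P unst, of x]) (auto simp: G_def)
  then have "P = (\<lambda>_. mat 1)"
    by auto
  with D have "dichotomy_with \<mu> (weighted \<mu> g A) (\<lambda>_. mat 1)"
    by simp
  from forward_exponent_if_dichotomy_identity[OF \<mu> inv this] obtain y where y: "y < g" "y \<in> G"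
    by (auto simp: G_def)
  with cInf_lower[OF y(2) bdd] show False
    by (simp add: g_def)
qed

text \<open>
  Likewise the supremum of the backward exponents cannot lie below \<open>s\<close>: the projector of a dichotomy
  there is zero, and its strict unstable rate exceeds the supremum.
\<close>

lemma backward_exponent_if_resolvent_below:
  fixes A :: "int \<Rightarrow> real^'n^'n"
  assumes \<mu>: "growth_rate \<mu>" and inv: "\<And>k. invertible (A k)"
    and bottom: "weighted_admits_dichotomy \<mu> A (-\<infinity>)"
    and below: "\<And>\<gamma>. \<gamma> < s \<Longrightarrow> weighted_admits_dichotomy \<mu> A (ereal \<gamma>)"
    and c: "c < s"
  shows "backward_exponent \<mu> A c"
proof (rule ccontr)
  assume not_c: "\<not> backward_exponent \<mu> A c"
  define G where "G = {x. backward_exponent \<mu> A x}"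
  define g where "g = Sup G"
  have upper: "x \<le> c" if "x \<in> G" for x
    using that not_c backward_exponent_antimono[OF \<mu>, of A x c] by (force simp: G_def)
  then have bdd: "bdd_above G"
    by (rule bdd_aboveI)
  from bottom obtain r where "dichotomy_with \<mu> (weighted \<mu> r A) (\<lambda>_. 0)"
    by (auto simp: weighted_admits_dichotomy_simps)
  from backward_exponent_if_dichotomy_zero[OF \<mu> inv this] have nonempty: "G \<noteq> {}"
    by (auto simp: G_def)
  have "g \<le> c"
    unfolding g_def by (rule cSup_least[OF nonempty upper])
  with c obtain P where D: "dichotomy_with \<mu> (weighted \<mu> g A) P"
    using below[of g] by (auto simp: weighted_admits_dichotomy_simps admits_dichotomy_def)
  obtain K \<alpha> where P: "invariant_projector A P" and \<alpha>: "\<alpha> < 0"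
    and stab: "\<And>k n. k \<ge> n \<Longrightarrow>
      onorm ((*v) (evolution A k n ** P n)) \<le> K * (\<mu> k / \<mu> n) powr (g + \<alpha>)"
    by (rule weighted_dichotomyE[OF \<mu> inv D]) (rule that)
  from \<alpha> obtain x where x: "x \<in> G" "g + \<alpha> < x"
    using less_cSupD[OF nonempty, of "g + \<alpha>"] by (auto simp: g_def)
  then have "P n = 0" for n
    by (intro projector_eq_zero[OF \<mu> inv P stab, of x]) (auto simp: G_def)
  then have "P = (\<lambda>_. 0)"
    by auto
  with D have "dichotomy_with \<mu> (weighted \<mu> g A) (\<lambda>_. 0)"
    by simp
  from backward_exponent_if_dichotomy_zero[OF \<mu> inv this] obtain y where y: "g < y" "y \<in> G"
    by (auto simp: G_def)
  with cSup_upper[OF y(2) bdd] show False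
    by (simp add: g_def)
qed

section \<open>Comparison of growth rates\<close>

lemma forward_exponent_weakly_faster:
  assumes "weakly_faster \<mu> \<omega>" "forward_exponent \<mu> A c" "c < 0"
  shows "forward_exponent \<omega> A c"
proof -
  from assms(1,3) obtain M where M: "M \<ge> 1"
    "\<And>k n. k \<ge> n \<Longrightarrow> (\<mu> k / \<mu> n) powr c \<le> M * (\<omega> k / \<omega> n) powr c"
    by (auto simp: weakly_faster_def)
  from assms(2) obtain K where K: "K \<ge> 1"
    "\<And>k n. k \<ge> n \<Longrightarrow> onorm ((*v) (evolution A k n)) \<le> K * (\<mu> k / \<mu> n) powr c"
    by (auto simp: forward_exponent_def)
  have "onorm ((*v) (evolution A k n)) \<le> K * M * (\<omega> k / \<omega> n) powr c" if "k \<ge> n" for k n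
    using order_trans[OF K(2)[OF that] mult_left_mono[OF M(2)[OF that], of K]] K(1)
    by (simp add: mult.assoc)
  moreover have "K * M \<ge> 1"
    using mult_mono[OF K(1) M(1)] K(1) by simp
  ultimately show ?thesis
    unfolding forward_exponent_def by blast
qed

text \<open>
  For \<open>k \<le> n\<close> a positive power of \<open>\<mu>(k)/\<mu>(n)\<close> is a negative power of \<open>\<mu>(n)/\<mu>(k)\<close>, to which weak
  comparability applies.
\<close>

lemma backward_exponent_weakly_faster:
  assumes \<mu>: "growth_rate \<mu>" and \<omega>: "growth_rate \<omega>"
    and "weakly_faster \<mu> \<omega>" "backward_exponent \<mu> A c" "0 < c"
  shows "backward_exponent \<omega> A c"
proof -
  have "- c < 0"
    using assms(5) by simp
  with assms(3) obtain M where M: "M \<ge> 1"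
    "\<And>k n. k \<ge> n \<Longrightarrow> (\<mu> k / \<mu> n) powr (- c) \<le> M * (\<omega> k / \<omega> n) powr (- c)"
    unfolding weakly_faster_def by meson
  have flip: "(\<nu> n / \<nu> k) powr (- c) = (\<nu> k / \<nu> n) powr c"
    if "growth_rate \<nu>" for \<nu> and k n :: int
    using growth_rate_pos[OF that, of k] growth_rate_pos[OF that, of n]
    by (simp add: powr_minus_divide powr_divide)
  from assms(4) obtain K where K: "K \<ge> 1"
    "\<And>k n. k \<le> n \<Longrightarrow> onorm ((*v) (evolution A k n)) \<le> K * (\<mu> k / \<mu> n) powr c"
    by (auto simp: backward_exponent_def)
  have "onorm ((*v) (evolution A k n)) \<le> K * M * (\<omega> k / \<omega> n) powr c" if "k \<le> n" for k n
    using order_trans[OF K(2)[OF that]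
        mult_left_mono[OF M(2)[OF that, unfolded flip[OF \<mu>] flip[OF \<omega>]], of K]] K(1)
    by (simp add: mult.assoc)
  moreover have "K * M \<ge> 1"
    using mult_mono[OF K(1) M(1)] K(1) by simp
  ultimately show ?thesis
    unfolding backward_exponent_def by blast
qed

text \<open>
  Exponents arbitrarily close to \<open>s\<close> suffice, which is why only the bounded window below \<open>t\<close> is
  asked for; the comparison of rates supplies exponents of one sign only, so \<open>t\<close> will be \<open>0\<close>.
\<close>

lemma weighted_admits_dichotomy_if_forward_exponents:
  fixes A :: "int \<Rightarrow> real^'n^'n"
  assumes \<omega>: "growth_rate \<omega>" and inv: "\<And>k. invertible (A k)"
    and s: "s < t" and exps: "\<And>c. s < c \<Longrightarrow> c < t \<Longrightarrow> forward_exponent \<omega> A c"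
    and \<gamma>: "ereal s < \<gamma>"
  shows "weighted_admits_dichotomy \<omega> A \<gamma>"
proof -
  have D: "dichotomy_with \<omega> (weighted \<omega> r A) (\<lambda>_. mat 1)" if r: "s < r" for r
  proof -
    obtain c where "s < c" "c < min t r"
      using dense[of s "min t r"] s r by auto
    then show ?thesis
      using dichotomy_identity_if_forward_exponent[OF \<omega> inv exps[of c]] by simp
  qed
  show ?thesis
  proof (cases \<gamma>)
    case (real r)
    with \<gamma> D show ?thesis
      by (auto simp: weighted_admits_dichotomy_simps admits_dichotomy_def)
  next
    case PInf
    with D[OF s] show ?thesis
      by (auto simp: weighted_admits_dichotomy_simps)
  qed (use \<gamma> in simp)
qed

lemma weighted_admits_dichotomy_if_backward_exponents:
  fixes A :: "int \<Rightarrow> real^'n^'n"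
  assumes \<omega>: "growth_rate \<omega>" and inv: "\<And>k. invertible (A k)"
    and s: "t < s" and exps: "\<And>c. t < c \<Longrightarrow> c < s \<Longrightarrow> backward_exponent \<omega> A c"
    and \<gamma>: "\<gamma> < ereal s"
  shows "weighted_admits_dichotomy \<omega> A \<gamma>"
proof -
  have D: "dichotomy_with \<omega> (weighted \<omega> r A) (\<lambda>_. 0)" if r: "r < s" for r
  proof -
    obtain c where "max t r < c" "c < s"
      using dense[of "max t r" s] s r by auto
    then show ?thesis
      using dichotomy_zero_if_backward_exponent[OF \<omega> inv exps[of c]] by simp
  qed
  show ?thesis
  proof (cases \<gamma>)
    case (real r)
    with \<gamma> D show ?thesis
      by (auto simp: weighted_admits_dichotomy_simps admits_dichotomy_def)
  next
    case MInf
    with D[OF s] show ?thesis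
      by (auto simp: weighted_admits_dichotomy_simps)
  qed (use \<gamma> in simp)
qed

lemma dichotomy_spectrum_subset_atMost_iff:
  "dichotomy_spectrum \<mu> A \<subseteq> {-\<infinity>..s} \<longleftrightarrow> (\<forall>\<gamma>>s. weighted_admits_dichotomy \<mu> A \<gamma>)"
  unfolding dichotomy_spectrum_def subset_eq
  by (auto simp: not_less)

lemma dichotomy_spectrum_subset_atLeast_iff:
  "dichotomy_spectrum \<mu> A \<subseteq> {s..\<infinity>} \<longleftrightarrow> (\<forall>\<gamma><s. weighted_admits_dichotomy \<mu> A \<gamma>)"
  unfolding dichotomy_spectrum_def subset_eq
  by (auto simp: not_less)

theorem theorem4p4:
  fixes \<mu> \<omega> :: "int \<Rightarrow> real"
    and A :: "int \<Rightarrow> real^'n^'n"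
    and a :: real
  assumes "\<And>k. invertible (A k)"
    and "growth_rate \<mu>"
    and "growth_rate \<omega>"
    and "weakly_faster \<mu> \<omega>"
    and "a > 0"
  shows "(dichotomy_spectrum \<mu> A \<subseteq> {-\<infinity>..ereal (- a)} \<longrightarrow>
            dichotomy_spectrum \<omega> A \<subseteq> {-\<infinity>..ereal (- a)}) \<and>
         (dichotomy_spectrum \<mu> A \<subseteq> {ereal a..\<infinity>} \<longrightarrow>
            dichotomy_spectrum \<omega> A \<subseteq> {ereal a..\<infinity>})"
proof (intro conjI impI)
  note inv = assms(1) and \<mu> = assms(2) and \<omega> = assms(3) and faster = assms(4) and a = assms(5)
  {
    assume "dichotomy_spectrum \<mu> A \<subseteq> {-\<infinity>..ereal (- a)}"
    then have res: "weighted_admits_dichotomy \<mu> A \<gamma>" if "ereal (- a) < \<gamma>" for \<gamma>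
      using that by (simp only: dichotomy_spectrum_subset_atMost_iff)
    have "forward_exponent \<mu> A c" if "- a < c" for c
      by (rule forward_exponent_if_resolvent_above[OF \<mu> inv _ _ that]) (simp_all add: res)
    then have exps: "forward_exponent \<omega> A c" if "- a < c" "c < 0" for c
      by (intro forward_exponent_weakly_faster[OF faster]) (use that in auto)
    have "- a < 0"
      using a by simp
    then have "weighted_admits_dichotomy \<omega> A \<gamma>" if "ereal (- a) < \<gamma>" for \<gamma>
      by (rule weighted_admits_dichotomy_if_forward_exponents[OF \<omega> inv _ exps that])
    then show "dichotomy_spectrum \<omega> A \<subseteq> {-\<infinity>..ereal (- a)}"
      unfolding dichotomy_spectrum_subset_atMost_iff by blast
  next
    assume "dichotomy_spectrum \<mu> A \<subseteq> {ereal a..\<infinity>}"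
    then have res: "weighted_admits_dichotomy \<mu> A \<gamma>" if "\<gamma> < ereal a" for \<gamma>
      using that by (simp only: dichotomy_spectrum_subset_atLeast_iff)
    have "backward_exponent \<mu> A c" if "c < a" for c
      by (rule backward_exponent_if_resolvent_below[OF \<mu> inv _ _ that]) (simp_all add: res)
    then have exps: "backward_exponent \<omega> A c" if "0 < c" "c < a" for c
      by (intro backward_exponent_weakly_faster[OF \<mu> \<omega> faster]) (use that in auto)
    have "weighted_admits_dichotomy \<omega> A \<gamma>" if "\<gamma> < ereal a" for \<gamma>
      by (rule weighted_admits_dichotomy_if_backward_exponents[OF \<omega> inv a exps that])
    then show "dichotomy_spectrum \<omega> A \<subseteq> {ereal a..\<infinity>}"
      unfolding dichotomy_spectrum_subset_atLeast_iff by blast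
  }
qed

end
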